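(* Let $\mathbb{F}$ be a field of characteristic not equal to $2$ with $|\mathbb{F}|\ge 4$, let $\mathcal{A}$ be a unital algebra over $\mathbb{F}$, and let $\mathcal{B}$ be an algebra containing $\mathcal{A}$ and sharing the same identity $I$ with $\mathcal{A}$, regarded as an $\mathcal{A}$-bimodule via the multiplication and addition of $\mathcal{B}$. Let $P\in\mathcal{A}$ be a non-trivial idempotent, $Q=I-P$, $E_1=P$, $E_2=Q$, $\mathcal{A}_{ij}=E_i\mathcal{A}E_j$, and assume that every element of $\mathcal{A}_{11}$ is a linear combination of invertible elements of $\mathcal{A}_{11}$ and every element of $\mathcal{A}_{22}$ is a linear combination of invertible elements of $\mathcal{A}_{22}$. Let $\mathcal{T}_{\mathcal{A}}=\{A\in\mathcal{A}: QAP=0\}$. Suppose $\mathcal{A}_{12}$ is faithful with respect to $\mathcal{B}$ and $C(\mathcal{T}_{\mathcal{A}},\mathcal{B})=\mathbb{F}I$. If $\delta\in L(\mathcal{A},\mathcal{B})$ is Jordan derivable at some $C\in\mathcal{T}_{\mathcal{A}}$, then $\delta|_{\mathcal{T}_{\mathcal{A}}}$ is a derivation from $\mathcal{T}_{\mathcal{A}}$ to $\mathcal{B}$.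
   Context: $L(\mathcal{A},\mathcal{B})$ is the set of all linear mappings from $\mathcal{A}$ to $\mathcal{B}$. For a subalgebra $\mathcal{S}\subseteq\mathcal{B}$, $C(\mathcal{S},\mathcal{B})=\{M\in\mathcal{B}: AM=MA\text{ for every }A\in\mathcal{S}\}$. A mapping $\delta\in L(\mathcal{A},\mathcal{B})$ is Jordan derivable at $C\in\mathcal{A}$ if $\delta(AB+BA)=\delta(A)B+A\delta(B)+\delta(B)A+B\delta(A)$ for all $A,B\in\mathcal{A}$ with $AB=C$. A linear mapping $\delta$ from a subalgebra $\mathcal{S}$ of $\mathcal{B}$ to $\mathcal{B}$ is a derivation if $\delta(AB)=\delta(A)B+A\delta(B)$ for all $A,B\in\mathcal{S}$. Non-trivial idempotent means an idempotent different from $0$ and $I$. Invertible in $\mathcal{A}_{ii}$ means invertible with respect to the unit $E_i$, with inverse in $\mathcal{A}_{ii}$. $\mathcal{A}_{12}$ is faithful with respect to $\mathcal{B}$ if for every $M\in\mathcal{B}$: $M\mathcal{A}_{12}=\{0\}$ implies $MP=0$, and $\mathcal{A}_{12}M=\{0\}$ implies $QM=0$. *)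

theory Defs
  imports Complex_Main
begin

text \<open>Associative unital algebras over a field. Such an algebra is a type of class
  \<open>ring_1\<close> together with an explicit scalar multiplication, so that the notions of
  \<^theory>\<open>HOL.Vector_Spaces\<close> (\<open>module.subspace scale\<close>, \<open>module.span scale\<close>) apply.\<close>

locale algebra_over = vector_space scale
  for scale :: "'k::field \<Rightarrow> 'b::ring_1 \<Rightarrow> 'b" +
  assumes scale_mult_left: "scale c x * y = scale c (x * y)"
    and scale_mult_right: "x * scale c y = scale c (x * y)"

definition subalgebra :: "('k::field \<Rightarrow> 'b::ring_1 \<Rightarrow> 'b) \<Rightarrow> 'b set \<Rightarrow> bool" where
  "subalgebra scale S \<longleftrightarrow> module.subspace scale S \<and> (\<forall>x\<in>S. \<forall>y\<in>S. x * y \<in> S)"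

text \<open>A linear mapping defined on a subspace \<open>S\<close> is represented by a total function; only its
  values on \<open>S\<close> matter, here and in the definitions below.\<close>

definition linear_map_on ::
  "('k::field \<Rightarrow> 'b::ring_1 \<Rightarrow> 'b) \<Rightarrow> 'b set \<Rightarrow> ('b \<Rightarrow> 'b) \<Rightarrow> bool" where
  "linear_map_on scale S f \<longleftrightarrow>
     (\<forall>x\<in>S. \<forall>y\<in>S. f (x + y) = f x + f y) \<and> (\<forall>c. \<forall>x\<in>S. f (scale c x) = scale c (f x))"

definition jordan_derivable_at :: "'b::ring_1 set \<Rightarrow> ('b \<Rightarrow> 'b) \<Rightarrow> 'b \<Rightarrow> bool" where
  "jordan_derivable_at \<A> \<delta> C \<longleftrightarrow>
     (\<forall>A\<in>\<A>. \<forall>B\<in>\<A>. A * B = C \<longrightarrow>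
        \<delta> (A * B + B * A) = \<delta> A * B + A * \<delta> B + \<delta> B * A + B * \<delta> A)"

definition derivation_on ::
  "('k::field \<Rightarrow> 'b::ring_1 \<Rightarrow> 'b) \<Rightarrow> 'b set \<Rightarrow> ('b \<Rightarrow> 'b) \<Rightarrow> bool" where
  "derivation_on scale S \<delta> \<longleftrightarrow>
     subalgebra scale S \<and> linear_map_on scale S \<delta> \<and>
     (\<forall>A\<in>S. \<forall>B\<in>S. \<delta> (A * B) = \<delta> A * B + A * \<delta> B)"

definition commutant :: "'b::ring_1 set \<Rightarrow> 'b set" where
  "commutant S = {M. \<forall>A\<in>S. A * M = M * A}"

definition peirce :: "'b::ring_1 set \<Rightarrow> 'b \<Rightarrow> 'b \<Rightarrow> 'b set" where
  "peirce \<A> E F = {E * A * F | A. A \<in> \<A>}"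

text \<open>Invertibility is relative to the unit \<open>E\<close> of \<open>E\<A>E\<close>, not to the unit of the ring.\<close>

definition peirce_units :: "'b::ring_1 set \<Rightarrow> 'b \<Rightarrow> 'b set" where
  "peirce_units \<A> E =
     {X \<in> peirce \<A> E E. \<exists>Y\<in>peirce \<A> E E. X * Y = E \<and> Y * X = E}"

definition triangular :: "'b::ring_1 set \<Rightarrow> 'b \<Rightarrow> 'b set" where
  "triangular \<A> P = {A \<in> \<A>. (1 - P) * A * P = 0}"

definition peirce12_faithful :: "'b::ring_1 set \<Rightarrow> 'b \<Rightarrow> bool" where
  "peirce12_faithful \<A> P \<longleftrightarrow>
     (\<forall>M. ((\<forall>X\<in>peirce \<A> P (1 - P). M * X = 0) \<longrightarrow> M * P = 0) \<and>
          ((\<forall>X\<in>peirce \<A> P (1 - P). X * M = 0) \<longrightarrow> (1 - P) * M = 0))"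

end

theory Submission
  imports Defs
begin

text \<open>Write \<open>Q = 1 - P\<close> and \<open>C = C\<^sub>1 + C\<^sub>1\<^sub>2 + C\<^sub>2\<close>. For invertible \<open>X \<in> \<A>\<^sub>1\<^sub>1\<close>, \<open>Y \<in> \<A>\<^sub>2\<^sub>2\<close>, any \<open>Z \<in> \<A>\<^sub>1\<^sub>2\<close>
  and any scalar \<open>t \<noteq> 0\<close>, the elements \<open>A = X + XZ + t\<inverse> C\<^sub>2 Y\<inverse>\<close> and
  \<open>B = X\<inverse> (C\<^sub>1 + C\<^sub>1\<^sub>2) + t (Y - ZY)\<close> satisfy \<open>AB = C\<close>. Comparing coefficients of \<open>t\<close>, the bilinear Jordan
  defect of \<open>\<delta>\<close> vanishes at \<open>(X + XZ, Y - ZY)\<close>, and then for all \<open>X\<close> and \<open>Y\<close> by linearity: the point \<open>C\<close>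
  has disappeared. After subtracting an inner derivation, \<open>\<delta>\<close> respects the Peirce decomposition, except
  that \<open>\<delta> Z\<close> may have a component \<open>\<phi> Z\<close> in \<open>Q\<B>P\<close>. The element \<open>Z (\<phi> W) - (\<phi> W) Z\<close> commutes with
  the triangular algebra, hence is a scalar, and this forces \<open>\<phi> = 0\<close>. Likewise \<open>\<delta> P + \<delta> Q\<close> is a scalar
  \<open>c\<close>, and faithfulness gives \<open>\<delta> (AB) = (\<delta> A) B + A (\<delta> B) - c AB\<close>. Finally \<open>c (AB + BA) = 0\<close> whenever
  \<open>AB = C\<close>, so \<open>c = 0\<close>.\<close>

text \<open>For linear \<open>\<delta>\<close> this is bilinear on \<open>\<A>\<close>, and Jordan
  derivability at \<open>C\<close> says exactly that it vanishes on the pairs in \<open>\<A>\<close>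
  with product \<open>C\<close>.\<close>

definition jordan_defect :: "('b::ring_1 \<Rightarrow> 'b) \<Rightarrow> 'b \<Rightarrow> 'b \<Rightarrow> 'b" where
  "jordan_defect \<delta> A B = \<delta> (A * B + B * A) - (\<delta> A * B + A * \<delta> B + \<delta> B * A + B * \<delta> A)"

lemma jordan_defect_eq_0D:
  "jordan_defect \<delta> A B = 0 \<Longrightarrow>
    \<delta> A * B + A * \<delta> B + \<delta> B * A + B * \<delta> A = \<delta> (A * B + B * A)"
  by (simp add: jordan_defect_def)

text \<open>Inner derivations obey the product rule and so contribute nothing to the defect. This
  allows the off-diagonal part of \<open>\<delta> P\<close> to be normalised away.\<close>

lemma jordan_defect_diff_inner:
  fixes \<delta> :: "'b::ring_1 \<Rightarrow> 'b"
  shows "jordan_defect (\<lambda>x. \<delta> x - (x * k - k * x)) A B = jordan_defect \<delta> A B"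
  by (simp add: jordan_defect_def algebra_simps)

text \<open>For idempotents this is the Peirce component of the whole ambient ring, where the values
  of \<open>\<delta>\<close> live. The fixed-point form turns membership directly into rewrite
  rules.\<close>

definition corner :: "'b::ring_1 \<Rightarrow> 'b \<Rightarrow> 'b set" where
  "corner E F = {x. E * x = x \<and> x * F = x}"

section \<open>Peirce calculus for \<open>P\<close> and \<open>Q\<close>\<close>

locale peirce_algebra = algebra_over scale
  for scale :: "'k::field \<Rightarrow> 'b::ring_1 \<Rightarrow> 'b" +
  fixes \<A> :: "'b set" and P Q :: 'b
  assumes char_not_2: "CHAR('k) \<noteq> 2"
    and subalgebra: "subalgebra scale \<A>" and one_in: "1 \<in> \<A>"
    and P_in: "P \<in> \<A>" and PP: "P * P = P" and P_nonzero: "P \<noteq> 0"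
    and Q_def: "Q = 1 - P"
    and faithful: "peirce12_faithful \<A> P"
    and commutant: "commutant (triangular \<A> P) = range (\<lambda>c. scale c 1)"
begin

lemma subspace: "subspace \<A>"
  and mult_in: "x \<in> \<A> \<Longrightarrow> y \<in> \<A> \<Longrightarrow> x * y \<in> \<A>"
  using subalgebra by (auto simp: subalgebra_def)

lemmas add_in = subspace_add[OF subspace]
lemmas diff_in = subspace_diff[OF subspace]
lemmas scale_in = subspace_scale[OF subspace]
lemmas zero_in = subspace_0[OF subspace]

lemma Q_in: "Q \<in> \<A>"
  unfolding Q_def by (intro diff_in one_in P_in)

lemmas closure = add_in diff_in scale_in zero_in mult_in one_in P_in Q_in

lemma PQ: "P * Q = 0" and QP: "Q * P = 0" and QQ: "Q * Q = Q"
  by (simp_all add: Q_def algebra_simps PP)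

lemma two_nonzero: "(2::'k) \<noteq> 0"
proof
  assume "(2::'k) = 0"
  then have "CHAR('k) dvd 2"
    by (metis of_nat_eq_0_iff_char_dvd of_nat_numeral)
  \<comment> \<open>Zero does not divide 2, so 1 is the only remaining divisor, and no field has
    characteristic 1.\<close>
  then have "CHAR('k) = 1"
    using char_not_2 dvd_imp_le[of "CHAR('k)" 2] by (cases "CHAR('k)") (auto simp: le_Suc_eq)
  then show False by simp
qed

lemma double_eq_0: "x + x = 0 \<Longrightarrow> x = 0" for x :: 'b
  by (metis scale_left_distrib scale_one one_add_one scale_eq_0_iff two_nonzero)

text \<open>The values 1 and -1 of \<open>t\<close> give \<open>a = 0\<close> and
  \<open>c = -b\<close>; a third value \<open>u\<close> then gives
  \<open>(u - inverse u) b = 0\<close>, where the factor is nonzero because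
  \<open>u * u \<noteq> 1\<close>.\<close>

lemma laurent_coeff_eq_0:
  fixes a b c :: 'b and u :: 'k
  assumes "u \<noteq> 0" "u \<noteq> 1" "u \<noteq> -1"
    and eq: "\<And>t. t \<noteq> 0 \<Longrightarrow> a + scale t b + scale (inverse t) c = 0"
  shows "b = 0"
proof -
  have p: "a + b + c = 0" and m: "a - b - c = 0"
    using eq[of 1] eq[of "-1"] by simp_all
  have "a + a = (a + b + c) + (a - b - c)" by (simp only: algebra_simps)
  then have a: "a = 0" unfolding p m by (intro double_eq_0[of a]) simp
  then have c: "c = - b" using p by (simp add: eq_neg_iff_add_eq_0 add.commute)
  have "scale (u - inverse u) b = 0"
    using eq[OF assms(1)] by (simp add: a c scale_left_diff_distrib)
  moreover have "u - inverse u \<noteq> 0"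
  proof
    assume "u - inverse u = 0"
    then have "u * u = 1" using assms(1) by (metis right_inverse right_minus_eq)
    then have "(u - 1) * (u + 1) = 0" by (simp add: distrib_left left_diff_distrib)
    then show False using assms(2,3) by (simp add: eq_neg_iff_add_eq_0)
  qed
  ultimately show ?thesis by simp
qed

text \<open>The variants with a trailing factor \<open>w\<close> keep the rules applicable inside
  products that are nested to the right.\<close>

lemma cornerP_left: "x \<in> corner P F \<Longrightarrow> P * x = x" "x \<in> corner P F \<Longrightarrow> Q * x = 0"
  "x \<in> corner P F \<Longrightarrow> P * (x * w) = x * w" "x \<in> corner P F \<Longrightarrow> Q * (x * w) = 0"
  by (auto simp: corner_def Q_def left_diff_distrib simp flip: mult.assoc)

lemma cornerQ_left: "x \<in> corner Q F \<Longrightarrow> Q * x = x" "x \<in> corner Q F \<Longrightarrow> P * x = 0"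
  "x \<in> corner Q F \<Longrightarrow> Q * (x * w) = x * w" "x \<in> corner Q F \<Longrightarrow> P * (x * w) = 0"
proof -
  assume "x \<in> corner Q F"
  then show Qx: "Q * x = x" by (simp add: corner_def)
  then show Px: "P * x = 0" by (metis PQ mult.assoc mult_zero_left)
  from Qx show "Q * (x * w) = x * w" by (simp flip: mult.assoc)
  from Px show "P * (x * w) = 0" by (simp flip: mult.assoc)
qed

lemma cornerP_right: "x \<in> corner E P \<Longrightarrow> x * P = x" "x \<in> corner E P \<Longrightarrow> x * Q = 0"
  "x \<in> corner E P \<Longrightarrow> x * (P * w) = x * w" "x \<in> corner E P \<Longrightarrow> x * (Q * w) = 0"
  by (auto simp: corner_def Q_def right_diff_distrib simp flip: mult.assoc)

lemma cornerQ_right: "x \<in> corner E Q \<Longrightarrow> x * Q = x" "x \<in> corner E Q \<Longrightarrow> x * P = 0"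
  "x \<in> corner E Q \<Longrightarrow> x * (Q * w) = x * w" "x \<in> corner E Q \<Longrightarrow> x * (P * w) = 0"
proof -
  assume "x \<in> corner E Q"
  then show Qx: "x * Q = x" by (simp add: corner_def)
  then show Px: "x * P = 0" by (metis QP mult.assoc mult_zero_right)
  from Qx show "x * (Q * w) = x * w" by (simp flip: mult.assoc)
  from Px show "x * (P * w) = 0" by (simp flip: mult.assoc)
qed

lemma corner_orth:
  "x \<in> corner E P \<Longrightarrow> y \<in> corner Q F \<Longrightarrow> x * y = 0"
  "x \<in> corner E Q \<Longrightarrow> y \<in> corner P F \<Longrightarrow> x * y = 0"
  "x \<in> corner E P \<Longrightarrow> y \<in> corner Q F \<Longrightarrow> x * (y * w) = 0"
  "x \<in> corner E Q \<Longrightarrow> y \<in> corner P F \<Longrightarrow> x * (y * w) = 0"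
  by (metis cornerP_right(1) cornerQ_right(1) cornerP_left(2,4) cornerQ_left(2,4)
      mult.assoc mult_zero_right)+

lemma idem_simps: "P * P = P" "P * (P * w) = P * w" "Q * Q = Q" "Q * (Q * w) = Q * w"
  "P * Q = 0" "P * (Q * w) = 0" "Q * P = 0" "Q * (P * w) = 0"
  by (simp_all add: PP QQ PQ QP flip: mult.assoc)

lemmas corner_simps = idem_simps cornerP_left cornerQ_left cornerP_right cornerQ_right corner_orth

lemma corner_sandwich:
  "P * x * P \<in> corner P P" "P * x * Q \<in> corner P Q"
  "Q * x * P \<in> corner Q P" "Q * x * Q \<in> corner Q Q"
  by (simp_all add: corner_def mult.assoc idem_simps)

lemma corner_closed: "x \<in> corner E F \<Longrightarrow> y \<in> corner F G \<Longrightarrow> x * y \<in> corner E G"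
  "x \<in> corner E F \<Longrightarrow> y \<in> corner E F \<Longrightarrow> x + y \<in> corner E F"
  "x \<in> corner E F \<Longrightarrow> y \<in> corner E F \<Longrightarrow> x - y \<in> corner E F"
  "x \<in> corner E F \<Longrightarrow> - x \<in> corner E F"
  "0 \<in> corner E F"
  "x \<in> corner E F \<Longrightarrow> scale c x \<in> corner E F"
proof -
  show "x * y \<in> corner E G" if "x \<in> corner E F" "y \<in> corner F G"
    using that by (metis (mono_tags, lifting) corner_def mem_Collect_eq mult.assoc)
qed (auto simp: corner_def distrib_left distrib_right left_diff_distrib right_diff_distrib
    scale_mult_left scale_mult_right)

lemma P_corner: "P \<in> corner P P" and Q_corner: "Q \<in> corner Q Q"
  by (simp_all add: corner_def PP QQ)

lemma peirce_decomposition: "x = P * x * P + P * x * Q + Q * x * P + Q * x * Q"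
  by (simp add: Q_def algebra_simps)

text \<open>Splits membership into the two facts used throughout: lying in \<open>\<A>\<close>, for
  linearity of \<open>\<delta>\<close>, and lying in a corner, for multiplication.\<close>

definition Peirce :: "'b \<Rightarrow> 'b \<Rightarrow> 'b set" where
  "Peirce E F = \<A> \<inter> corner E F"

lemma Peirce_eq: 
  assumes "E = P \<or> E = Q" "F = P \<or> F = Q" 
  shows "peirce \<A> E F = Peirce E F"
proof
  show "peirce \<A> E F \<subseteq> Peirce E F"
    using assms by (auto simp: peirce_def Peirce_def intro!: closure corner_sandwich)
  show "Peirce E F \<subseteq> peirce \<A> E F"
  proof
    fix x assume "x \<in> Peirce E F"
    then have "x \<in> \<A>" "x = E * x * F" by (auto simp: Peirce_def corner_def)
    then show "x \<in> peirce \<A> E F" unfolding peirce_def by blast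
  qed
qed

lemma Peirce_D: "x \<in> Peirce E F \<Longrightarrow> x \<in> \<A>" "x \<in> Peirce E F \<Longrightarrow> x \<in> corner E F"
  by (auto simp: Peirce_def)

lemma P_Peirce: "P \<in> Peirce P P" and Q_Peirce: "Q \<in> Peirce Q Q"
  by (simp_all add: Peirce_def P_corner Q_corner closure)

lemma Peirce_closed: "x \<in> Peirce E F \<Longrightarrow> y \<in> Peirce F G \<Longrightarrow> x * y \<in> Peirce E G"
  "x \<in> Peirce E F \<Longrightarrow> y \<in> Peirce E F \<Longrightarrow> x + y \<in> Peirce E F"
  "x \<in> Peirce E F \<Longrightarrow> - x \<in> Peirce E F"
  using subspace_neg[OF subspace] by (auto simp: Peirce_def intro: closure corner_closed)

lemma triangularE:
  assumes "T \<in> triangular \<A> P"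
  obtains X Z Y where "X \<in> Peirce P P" "Z \<in> Peirce P Q" "Y \<in> Peirce Q Q" "T = X + Z + Y"
proof
  from assms have T: "T \<in> \<A>" "Q * T * P = 0" by (auto simp: triangular_def Q_def)
  show "P * T * P \<in> Peirce P P" "P * T * Q \<in> Peirce P Q" "Q * T * Q \<in> Peirce Q Q"
    using T by (auto simp: Peirce_def intro!: closure corner_sandwich)
  show "T = P * T * P + P * T * Q + Q * T * Q"
    using peirce_decomposition[of T] T by simp
qed

lemma Peirce_subset_triangular:
  "Peirce P P \<subseteq> triangular \<A> P" "Peirce P Q \<subseteq> triangular \<A> P" "Peirce Q Q \<subseteq> triangular \<A> P"
  by (auto simp: Peirce_def triangular_def mult.assoc corner_simps simp flip: Q_def)

lemma subalgebra_triangular: "subalgebra scale (triangular \<A> P)"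
proof -
  have "subspace (triangular \<A> P)"
    by (auto simp: subspace_def triangular_def closure distrib_left distrib_right
        scale_mult_left scale_mult_right)
  moreover have "x * y \<in> triangular \<A> P" if "x \<in> triangular \<A> P" "y \<in> triangular \<A> P" for x y
  proof -
    from that have x: "Q * x * P = 0" and y: "Q * y * P = 0" and A: "x \<in> \<A>" "y \<in> \<A>"
      by (auto simp: triangular_def Q_def)
    \<comment> \<open>Insert \<open>P + Q = 1\<close> between \<open>x\<close> and
      \<open>y\<close>.\<close>
    have "Q * (x * y) * P = (Q * x * P) * y * P + Q * x * (Q * y * P)"
      by (simp add: Q_def algebra_simps)
    then show ?thesis using x y A by (auto simp: triangular_def closure Q_def[symmetric])
  qed
  ultimately show ?thesis by (simp add: subalgebra_def)
qed

lemma faithful_left: "M \<in> corner E P \<Longrightarrow> (\<And>Z. Z \<in> Peirce P Q \<Longrightarrow> M * Z = 0) \<Longrightarrow> M = 0"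
  using faithful Peirce_eq[of P Q] by (auto simp: peirce12_faithful_def corner_def simp flip: Q_def)

lemma faithful_right: "M \<in> corner Q F \<Longrightarrow> (\<And>Z. Z \<in> Peirce P Q \<Longrightarrow> Z * M = 0) \<Longrightarrow> M = 0"
  using faithful Peirce_eq[of P Q] by (auto simp: peirce12_faithful_def corner_def simp flip: Q_def)

text \<open>The triangular algebra is the sum of these three Peirce components, so \<open>K\<close>
  lies in its commutant, which consists of scalars by assumption.\<close>

lemma commuting_scalar:
  assumes "\<And>X. X \<in> Peirce P P \<Longrightarrow> X * K = K * X"
    and "\<And>Z. Z \<in> Peirce P Q \<Longrightarrow> Z * K = K * Z"
    and "\<And>Y. Y \<in> Peirce Q Q \<Longrightarrow> Y * K = K * Y"
  obtains c where "K = scale c 1"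
proof -
  have "T * K = K * T" if "T \<in> triangular \<A> P" for T
    using that by (rule triangularE) (simp add: assms distrib_left distrib_right)
  then have "K \<in> commutant (triangular \<A> P)" by (auto simp: commutant_def)
  then show ?thesis using that unfolding commutant by auto
qed

lemma zero_Peirce: "0 \<in> Peirce E F"
  by (simp add: Peirce_def closure corner_closed)

lemma corner_from_sandwich:
  "P * x * Q = 0 \<Longrightarrow> Q * x * P = 0 \<Longrightarrow> Q * x * Q = 0 \<Longrightarrow> x \<in> corner P P"
  "P * x * P = 0 \<Longrightarrow> P * x * Q = 0 \<Longrightarrow> Q * x * P = 0 \<Longrightarrow> x \<in> corner Q Q"
  "P * x * P = 0 \<Longrightarrow> Q * x * P = 0 \<Longrightarrow> Q * x * Q = 0 \<Longrightarrow> x \<in> corner P Q"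
  using peirce_decomposition[of x] corner_sandwich[of x] by simp_all

end

section \<open>Bilinearity of the defect and removal of the point \<open>C\<close>\<close>

locale peirce_linear_map = peirce_algebra scale \<A> P Q
  for scale :: "'k::field \<Rightarrow> 'b::ring_1 \<Rightarrow> 'b" and \<A> P Q +
  fixes \<delta> :: "'b \<Rightarrow> 'b"
  assumes linear: "linear_map_on scale \<A> \<delta>"
begin

lemma map_add: "x \<in> \<A> \<Longrightarrow> y \<in> \<A> \<Longrightarrow> \<delta> (x + y) = \<delta> x + \<delta> y"
  and map_scale: "x \<in> \<A> \<Longrightarrow> \<delta> (scale c x) = scale c (\<delta> x)"
  using linear by (auto simp: linear_map_on_def)

lemma map_zero: "\<delta> 0 = 0"
  using map_scale[OF zero_in, of 0] by simp

abbreviation defect :: "'b \<Rightarrow> 'b \<Rightarrow> 'b" where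
  "defect \<equiv> jordan_defect \<delta>"

lemma defect_add_left:
  "A \<in> \<A> \<Longrightarrow> A' \<in> \<A> \<Longrightarrow> B \<in> \<A> \<Longrightarrow> defect (A + A') B = defect A B + defect A' B"
  by (simp add: jordan_defect_def distrib_left distrib_right map_add closure)

lemma defect_add_right:
  "A \<in> \<A> \<Longrightarrow> B \<in> \<A> \<Longrightarrow> B' \<in> \<A> \<Longrightarrow> defect A (B + B') = defect A B + defect A B'"
  by (simp add: jordan_defect_def distrib_left distrib_right map_add closure)

lemma defect_scale_left: "A \<in> \<A> \<Longrightarrow> B \<in> \<A> \<Longrightarrow> defect (scale c A) B = scale c (defect A B)"
  by (simp add: jordan_defect_def scale_mult_left scale_mult_right map_scale closure
      scale_right_diff_distrib flip: scale_right_distrib)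

lemma defect_scale_right: "A \<in> \<A> \<Longrightarrow> B \<in> \<A> \<Longrightarrow> defect A (scale c B) = scale c (defect A B)"
  by (simp add: jordan_defect_def scale_mult_left scale_mult_right map_scale closure
      scale_right_diff_distrib flip: scale_right_distrib)

lemma defect_zero: "B \<in> \<A> \<Longrightarrow> defect 0 B = 0" "B \<in> \<A> \<Longrightarrow> defect B 0 = 0"
  by (simp_all add: jordan_defect_def map_zero)

lemma defect_minus_right: "A \<in> \<A> \<Longrightarrow> B \<in> \<A> \<Longrightarrow> defect A (- B) = - defect A B"
  using defect_scale_right[of A B "-1"] by simp

lemma defect_minus_left: "A \<in> \<A> \<Longrightarrow> B \<in> \<A> \<Longrightarrow> defect (- A) B = - defect A B"
  using defect_scale_left[of A B "-1"] by simp

lemma defect_diff_right: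
  "A \<in> \<A> \<Longrightarrow> B \<in> \<A> \<Longrightarrow> B' \<in> \<A> \<Longrightarrow> defect A (B - B') = defect A B - defect A B'"
  using defect_add_right[of A B "- B'"] subspace_neg[OF subspace] by (simp add: defect_minus_right)

lemma defect_units:
  assumes u: "u \<noteq> 0" "u \<noteq> 1" "u \<noteq> (-1::'k)"
    and C: "C \<in> triangular \<A> P" "jordan_derivable_at \<A> \<delta> C"
    and X: "X \<in> peirce_units \<A> P" and Y: "Y \<in> peirce_units \<A> Q" and Z: "Z \<in> Peirce P Q"
  shows "defect (X + X * Z) (Y - Z * Y) = 0"
proof -
  obtain C1 C12 C2 where c: "C1 \<in> Peirce P P" "C12 \<in> Peirce P Q" "C2 \<in> Peirce Q Q"
    and C_eq: "C = C1 + C12 + C2"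
    using triangularE[OF C(1)] by metis
  from X obtain X' where x: "X \<in> Peirce P P" "X' \<in> Peirce P P" "X * X' = P"
    by (auto simp: peirce_units_def Peirce_eq)
  from Y obtain Y' where y: "Y \<in> Peirce Q Q" "Y' \<in> Peirce Q Q" "Y' * Y = Q"
    by (auto simp: peirce_units_def Peirce_eq)
  note A = c[THEN Peirce_D(1)] x(1,2)[THEN Peirce_D(1)] y(1,2)[THEN Peirce_D(1)] Z[THEN Peirce_D(1)]
  note K = c[THEN Peirce_D(2)] x(1,2)[THEN Peirce_D(2)] y(1,2)[THEN Peirce_D(2)] Z[THEN Peirce_D(2)]
  define A0 A1 B0 B1 where "A0 = X + X * Z" and "A1 = C2 * Y'" and "B0 = X' * (C1 + C12)"
    and "B1 = Y - Z * Y"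
  note defs = A0_def A1_def B0_def B1_def
  have in_A: "A0 \<in> \<A>" "A1 \<in> \<A>" "B0 \<in> \<A>" "B1 \<in> \<A>"
    using A by (auto simp: defs intro!: closure)
  have XX': "X * (X' * w) = P * w" and Y'Y: "Y' * (Y * w) = Q * w" for w
    using x(3) y(3) by (simp_all flip: mult.assoc)
  \<comment> \<open>The mixed products vanish, so rescaling \<open>A1\<close> and \<open>B1\<close>
    by inverse factors leaves the total product \<open>C\<close> unchanged. For
    \<open>A0 * B1\<close> the reason is \<open>(P + Z) * (Q - Z) = 0\<close>.\<close>
  have prods: "A0 * B0 = C1 + C12" "A0 * B1 = 0" "A1 * B0 = 0" "A1 * B1 = C2"
    using K x(3) y(3)
    by (simp_all add: defs distrib_left distrib_right left_diff_distrib right_diff_distrib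
        mult.assoc corner_simps XX' Y'Y)
  \<comment> \<open>The left side is the expanded defect at a pair with product \<open>C\<close>;
    its coefficient of \<open>t\<close> is the defect to be shown zero.\<close>
  have "(defect A0 B0 + defect A1 B1) + scale t (defect A0 B1)
      + scale (inverse t) (defect A1 B0) = 0" if "t \<noteq> 0" for t
  proof -
    let ?A = "A0 + scale (inverse t) A1" and ?B = "B0 + scale t B1"
    have in': "scale (inverse t) A1 \<in> \<A>" "scale t B1 \<in> \<A>" "?A \<in> \<A>" "?B \<in> \<A>"
      using in_A by (auto intro!: closure)
    have "?A * ?B = C"
      using \<open>t \<noteq> 0\<close> by (simp add: distrib_left distrib_right scale_mult_left scale_mult_right prods C_eq)
    then have "defect ?A ?B = 0"
      using C(2) in' by (simp add: jordan_derivable_at_def jordan_defect_def)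
    then show ?thesis
      using in_A in' \<open>t \<noteq> 0\<close>
      by (simp add: defect_add_left defect_add_right defect_scale_left defect_scale_right
          scale_right_distrib ac_simps)
  qed
  from laurent_coeff_eq_0[OF u this] show ?thesis by (simp add: defs)
qed

text \<open>With \<open>Z\<close> fixed, the defect is linear in \<open>X\<close> and in
  \<open>Y\<close> separately, so its zero set in either variable is a subspace. Passing to spans
  first in \<open>X\<close>, then in \<open>Y\<close>, replaces units by arbitrary elements.\<close>

lemma defect_orthogonal:
  assumes u: "u \<noteq> 0" "u \<noteq> 1" "u \<noteq> (-1::'k)"
    and C: "C \<in> triangular \<A> P" "jordan_derivable_at \<A> \<delta> C"
    and spanP: "peirce \<A> P P \<subseteq> span (peirce_units \<A> P)"
    and spanQ: "peirce \<A> Q Q \<subseteq> span (peirce_units \<A> Q)"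
    and X: "X \<in> Peirce P P" and Y: "Y \<in> Peirce Q Q" and Z: "Z \<in> Peirce P Q"
  shows "defect (X + X * Z) (Y - Z * Y) = 0"
proof -
  note ZA = Peirce_D(1)[OF Z]
  have units: "peirce_units \<A> P \<subseteq> \<A>" "peirce_units \<A> Q \<subseteq> \<A>"
    by (auto simp: peirce_units_def Peirce_eq Peirce_def)
  have step: "defect (X + X * Z) (Y - Z * Y) = 0" if Y: "Y \<in> peirce_units \<A> Q" for Y
  proof -
    let ?S = "{X \<in> \<A>. defect (X + X * Z) (Y - Z * Y) = 0}"
    have YA: "Y - Z * Y \<in> \<A>" using units Y ZA by (auto intro!: closure)
    have "defect ((X + X') + (X + X') * Z) (Y - Z * Y) = 0"
      if "X \<in> ?S" "X' \<in> ?S" for X X'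
    proof -
      have eq: "(X + X') + (X + X') * Z = (X + X * Z) + (X' + X' * Z)" by (simp add: distrib_right)
      have "X + X * Z \<in> \<A>" "X' + X' * Z \<in> \<A>" using that ZA by (auto intro: closure)
      then show ?thesis unfolding eq using that YA by (simp only: defect_add_left) simp
    qed
    moreover have "defect (scale r X + scale r X * Z) (Y - Z * Y) = 0" if "X \<in> ?S" for X r
    proof -
      have "scale r X + scale r X * Z = scale r (X + X * Z)"
        by (simp add: scale_right_distrib scale_mult_left)
      with that show ?thesis using YA ZA by (simp add: defect_scale_left closure)
    qed
    ultimately have "subspace ?S"
      using YA by (auto simp: subspace_def closure defect_zero)
    then have "span (peirce_units \<A> P) \<subseteq> ?S"
      using units defect_units[OF u C _ Y Z] by (intro span_minimal) auto
    then show ?thesis using X spanP by (auto simp: Peirce_eq)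
  qed
  let ?S = "{Y \<in> \<A>. defect (X + X * Z) (Y - Z * Y) = 0}"
  have XA: "X + X * Z \<in> \<A>" using X ZA by (auto intro!: closure dest: Peirce_D)
  have "defect (X + X * Z) ((Y + Y') - Z * (Y + Y')) = 0"
    if "Y \<in> ?S" "Y' \<in> ?S" for Y Y'
  proof -
    have eq: "(Y + Y') - Z * (Y + Y') = (Y - Z * Y) + (Y' - Z * Y')" by (simp add: distrib_left)
    have "Y - Z * Y \<in> \<A>" "Y' - Z * Y' \<in> \<A>" using that ZA by (auto intro: closure)
    then show ?thesis unfolding eq using that XA by (simp only: defect_add_right) simp
  qed
  moreover have "defect (X + X * Z) (scale r Y - Z * scale r Y) = 0" if "Y \<in> ?S" for Y r
  proof -
    have "scale r Y - Z * scale r Y = scale r (Y - Z * Y)"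
      by (simp add: scale_right_diff_distrib scale_mult_right)
    with that show ?thesis using XA ZA by (simp add: defect_scale_right closure)
  qed
  ultimately have "subspace ?S"
    using XA by (auto simp: subspace_def closure defect_zero)
  then have "span (peirce_units \<A> Q) \<subseteq> ?S"
    using units step by (intro span_minimal) auto
  then show ?thesis using Y spanQ by (auto simp: Peirce_eq)
qed

text \<open>The correction by a scalar is unavoidable at this stage: both products of
  \<open>X + X * Z\<close> and \<open>Y - Z * Y\<close> are zero, so every scalar multiple of the
  identity map also has zero defect there.\<close>

lemma perturbed_derivation:
  assumes defect: "\<And>X Y Z. X \<in> Peirce P P \<Longrightarrow> Y \<in> Peirce Q Q \<Longrightarrow> Z \<in> Peirce P Q \<Longrightarrow>
      defect (X + X * Z) (Y - Z * Y) = 0"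
    and normalized: "P * \<delta> P * Q = 0" "Q * \<delta> P * P = 0"
  obtains c where "\<And>A B. A \<in> triangular \<A> P \<Longrightarrow> B \<in> triangular \<A> P \<Longrightarrow>
      \<delta> (A * B) = \<delta> A * B + A * \<delta> B - scale c (A * B)"
proof -
  note D = Peirce_D
  have defect_XY: "defect X Y = 0" if "X \<in> Peirce P P" "Y \<in> Peirce Q Q" for X Y
    using defect[OF that zero_Peirce] by simp
  \<comment> \<open>Substituting \<open>- Z\<close> for \<open>Z\<close> separates the part of the
    defect that is linear in \<open>Z\<close> from the quadratic part; each vanishes on its
    own.\<close>
  have quad: "defect (X * Z) (Z * Y) = 0 \<and> defect (X * Z) Y = defect X (Z * Y)"
    if X: "X \<in> Peirce P P" and Y: "Y \<in> Peirce Q Q" and Z: "Z \<in> Peirce P Q" for X Y Z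
  proof -
    have in_A: "X \<in> \<A>" "Y \<in> \<A>" "X * Z \<in> \<A>" "Z * Y \<in> \<A>" "- (X * Z) \<in> \<A>"
      using D(1)[OF X] D(1)[OF Y] D(1)[OF Z] by (auto intro!: closure subspace_neg[OF subspace])
    have b: "defect (X * Z) Y = defect X (Z * Y) + defect (X * Z) (Z * Y)"
      using defect[OF X Y Z] in_A defect_XY[OF X Y]
      by (simp add: defect_add_left defect_diff_right closure add_eq_0_iff2)
    have "defect X (Z * Y) = defect (X * Z) Y + defect (X * Z) (Z * Y)"
      using defect[OF X Y Peirce_closed(3)[OF Z]] in_A defect_XY[OF X Y]
        defect_add_left[of X "- (X * Z)" "Y + Z * Y"]
      by (simp add: defect_minus_left defect_add_right closure algebra_simps)
    with b have "defect (X * Z) (Z * Y) + defect (X * Z) (Z * Y) = 0"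
      by (metis add.assoc add_cancel_left_right)
    then have "defect (X * Z) (Z * Y) = 0" by (rule double_eq_0)
    with b show ?thesis by simp
  qed

  \<comment> \<open>Images of the Peirce components\<close>
  have eq_XY: "\<delta> X * Y + X * \<delta> Y + \<delta> Y * X + Y * \<delta> X = 0"
    if "X \<in> Peirce P P" "Y \<in> Peirce Q Q" for X Y
    using jordan_defect_eq_0D[OF defect_XY[OF that]] that[THEN D(2)]
    by (simp add: map_zero corner_simps)

  have sandwich_Q: "P * \<delta> Q * Q = 0" "Q * \<delta> Q * P = 0"
  proof -
    have "P * (\<delta> P * Q + P * \<delta> Q + \<delta> Q * P + Q * \<delta> P) * Q = P * \<delta> P * Q + P * \<delta> Q * Q"
      "Q * (\<delta> P * Q + P * \<delta> Q + \<delta> Q * P + Q * \<delta> P) * P = Q * \<delta> P * P + Q * \<delta> Q * P"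
      by (simp_all add: distrib_left distrib_right mult.assoc idem_simps)
    then show "P * \<delta> Q * Q = 0" "Q * \<delta> Q * P = 0"
      by (simp_all add: eq_XY[OF P_Peirce Q_Peirce] normalized)
  qed
  \<comment> \<open>Sandwiching the identity for the pair \<open>X\<close>, \<open>Q\<close>
    isolates the unwanted components of \<open>\<delta> X\<close>; the one in the \<open>Q\<close>,
    \<open>Q\<close> corner appears twice.\<close>
  have map_X: "\<delta> X \<in> corner P P" if X: "X \<in> Peirce P P" for X
  proof (rule corner_from_sandwich)
    note eq = eq_XY[OF X Q_Peirce] and XC = D(2)[OF X]
    let ?E = "\<delta> X * Q + X * \<delta> Q + \<delta> Q * X + Q * \<delta> X"
    have "Q * ?E * Q = Q * \<delta> X * Q + Q * \<delta> X * Q"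
      "P * ?E * Q = P * \<delta> X * Q + X * (P * \<delta> Q * Q)"
      "Q * ?E * P = (Q * \<delta> Q * P) * X + Q * \<delta> X * P"
      using XC by (simp_all add: distrib_left distrib_right mult.assoc corner_simps)
    then show "Q * \<delta> X * Q = 0" "P * \<delta> X * Q = 0" "Q * \<delta> X * P = 0"
      using double_eq_0[of "Q * \<delta> X * Q"] by (simp_all add: eq sandwich_Q)
  qed
  have map_Y: "\<delta> Y \<in> corner Q Q" if Y: "Y \<in> Peirce Q Q" for Y
  proof (rule corner_from_sandwich)
    note eq = eq_XY[OF P_Peirce Y] and YC = D(2)[OF Y]
    let ?E = "\<delta> P * Y + P * \<delta> Y + \<delta> Y * P + Y * \<delta> P"
    have "P * ?E * P = P * \<delta> Y * P + P * \<delta> Y * P"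
      "P * ?E * Q = (P * \<delta> P * Q) * Y + P * \<delta> Y * Q"
      "Q * ?E * P = Q * \<delta> Y * P + Y * (Q * \<delta> P * P)"
      using YC by (simp_all add: distrib_left distrib_right mult.assoc corner_simps)
    then show "P * \<delta> Y * P = 0" "P * \<delta> Y * Q = 0" "Q * \<delta> Y * P = 0"
      using double_eq_0[of "P * \<delta> Y * P"] by (simp_all add: eq normalized)
  qed

  have eq_Z: "\<delta> (X * Z) * Y + X * Z * \<delta> Y + Y * \<delta> (X * Z) =
      \<delta> X * Z * Y + X * \<delta> (Z * Y) + \<delta> (Z * Y) * X"
    if X: "X \<in> Peirce P P" and Y: "Y \<in> Peirce Q Q" and Z: "Z \<in> Peirce P Q" for X Y Z
  proof -
    note C = that[THEN D(2)] map_X[OF X] map_Y[OF Y]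
    \<comment> \<open>Both pairs have the same Jordan product \<open>X * Z * Y\<close>, so equality
      of their defects no longer involves \<open>\<delta>\<close> of that product.\<close>
    have "(X * Z) * Y + Y * (X * Z) = X * (Z * Y) + (Z * Y) * X"
      using C by (simp add: mult.assoc corner_simps)
    then have "\<delta> (X * Z) * Y + (X * Z) * \<delta> Y + \<delta> Y * (X * Z) + Y * \<delta> (X * Z) =
        \<delta> X * (Z * Y) + X * \<delta> (Z * Y) + \<delta> (Z * Y) * X + (Z * Y) * \<delta> X"
      using conjunct2[OF quad[OF that]] unfolding jordan_defect_def by (metis diff_left_imp_eq)
    then show ?thesis
      using C by (simp add: mult.assoc corner_simps)
  qed
  have map_Z: "P * \<delta> Z * P = 0" "Q * \<delta> Z * Q = 0" "\<delta> P * Z = Z * \<delta> Q"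
    if Z: "Z \<in> Peirce P Q" for Z
  proof -
    note ZC = D(2)[OF Z] and PC = map_X[OF P_Peirce] and QC = map_Y[OF Q_Peirce]
    \<comment> \<open>The case \<open>X = P\<close>, \<open>Y = Q\<close>: the two sides are
      compared corner by corner.\<close>
    let ?L = "\<delta> Z * Q + Z * \<delta> Q + Q * \<delta> Z" and ?R = "\<delta> P * Z + P * \<delta> Z + \<delta> Z * P"
    have LR: "?L = ?R"
      using eq_Z[OF P_Peirce Q_Peirce Z] ZC by (simp add: mult.assoc corner_simps)
    have "P * ?L * P = 0" "P * ?R * P = P * \<delta> Z * P + P * \<delta> Z * P"
      "Q * ?R * Q = 0" "Q * ?L * Q = Q * \<delta> Z * Q + Q * \<delta> Z * Q"
      "P * ?L * Q = P * \<delta> Z * Q + Z * \<delta> Q" "P * ?R * Q = \<delta> P * Z + P * \<delta> Z * Q"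
      using ZC PC QC by (simp_all add: distrib_left distrib_right mult.assoc corner_simps)
    then show "P * \<delta> Z * P = 0" "Q * \<delta> Z * Q = 0" "\<delta> P * Z = Z * \<delta> Q"
      using double_eq_0[of "P * \<delta> Z * P"] double_eq_0[of "Q * \<delta> Z * Q"] unfolding LR by simp_all
  qed

  \<comment> \<open>Vanishing of the component of \<open>\<delta> Z\<close> in the \<open>Q\<close>,
    \<open>P\<close> corner\<close>
  define \<phi> where "\<phi> Z = Q * \<delta> Z * P" for Z
  have \<phi>_corner: "\<phi> Z \<in> corner Q P" for Z
    by (simp add: \<phi>_def corner_sandwich)
  have \<phi>_add: "\<phi> (Z + W) = \<phi> Z + \<phi> W" if "Z \<in> Peirce P Q" "W \<in> Peirce P Q" for Z W
    using that by (simp add: \<phi>_def map_add D distrib_left distrib_right)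
  have \<phi>_XY: "Y * \<phi> (X * Z) = \<phi> (Z * Y) * X"
    if X: "X \<in> Peirce P P" and Y: "Y \<in> Peirce Q Q" and Z: "Z \<in> Peirce P Q" for X Y Z
  proof -
    have "Q * (\<delta> (X * Z) * Y + X * Z * \<delta> Y + Y * \<delta> (X * Z)) * P =
        Q * (\<delta> X * Z * Y + X * \<delta> (Z * Y) + \<delta> (Z * Y) * X) * P"
      by (simp add: eq_Z[OF that])
    then show ?thesis
      using that[THEN D(2)] map_X[OF X] map_Y[OF Y]
      by (simp add: \<phi>_def distrib_left distrib_right mult.assoc corner_simps)
  qed
  have \<phi>_X: "\<phi> (X * Z) = \<phi> Z * X" if "X \<in> Peirce P P" "Z \<in> Peirce P Q" for X Z
    using \<phi>_XY[OF that(1) Q_Peirce that(2)] \<phi>_corner[of "X * Z"] D(2)[OF that(2)] by (simp add: corner_simps)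
  have \<phi>_Y: "\<phi> (Z * Y) = Y * \<phi> Z" if "Y \<in> Peirce Q Q" "Z \<in> Peirce P Q" for Y Z
    using \<phi>_XY[OF P_Peirce that] \<phi>_corner[of "Z * Y"] D(2)[OF that(2)] by (simp add: corner_simps)
  have \<phi>_square: "Z * \<phi> Z = 0" "\<phi> Z * Z = 0" if Z: "Z \<in> Peirce P Q" for Z
  proof -
    note ZC = D(2)[OF Z]
    \<comment> \<open>The quadratic part at \<open>X = P\<close>, \<open>Y = Q\<close> is the defect
      of the pair \<open>Z\<close>, \<open>Z\<close>, and \<open>Z * Z = 0\<close>.\<close>
    have "(\<delta> Z * Z + Z * \<delta> Z) + (\<delta> Z * Z + Z * \<delta> Z) = 0"
      using jordan_defect_eq_0D[OF conjunct1[OF quad[OF P_Peirce Q_Peirce Z]]] ZC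
      by (simp add: map_zero corner_simps ac_simps)
    then have "\<delta> Z * Z + Z * \<delta> Z = 0" by (rule double_eq_0)
    then have "P * (\<delta> Z * Z + Z * \<delta> Z) * P = 0" "Q * (\<delta> Z * Z + Z * \<delta> Z) * Q = 0"
      by simp_all
    then show "Z * \<phi> Z = 0" "\<phi> Z * Z = 0"
      using ZC by (simp_all add: \<phi>_def distrib_left distrib_right mult.assoc corner_simps)
  qed
  \<comment> \<open>Polarisation: apply the square identities to \<open>Z + W\<close>.\<close>
  have \<phi>_swap: "Z * \<phi> W = - (W * \<phi> Z)" "\<phi> Z * W = - (\<phi> W * Z)"
    if "Z \<in> Peirce P Q" "W \<in> Peirce P Q" for Z W
    using \<phi>_square[OF Peirce_closed(2)[OF that]] that
    by (simp_all add: \<phi>_add distrib_left distrib_right \<phi>_square eq_neg_iff_add_eq_0 add.commute)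
  have \<phi>_0: "\<phi> W = 0" if W: "W \<in> Peirce P Q" for W
  proof (rule faithful_right[OF \<phi>_corner])
    fix Z assume Z: "Z \<in> Peirce P Q"
    \<comment> \<open>Block diagonal with blocks \<open>Z * \<phi> W\<close> and
      \<open>- (\<phi> W * Z)\<close>. Commutation follows by repeatedly exchanging arguments with
      \<open>\<phi>_swap\<close>, using that \<open>\<phi>\<close> reverses the side on which
      \<open>X\<close> and \<open>Y\<close> act.\<close>
    let ?K = "Z * \<phi> W - \<phi> W * Z"
    note C = D(2)[OF W] D(2)[OF Z] \<phi>_corner[of W]
    obtain c where c: "?K = scale c 1"
    proof (rule commuting_scalar)
      fix X assume X: "X \<in> Peirce P P"
      have "X * Z * \<phi> W = - (W * \<phi> Z * X)"
        using \<phi>_swap(1)[OF Peirce_closed(1)[OF X Z] W] \<phi>_X[OF X Z] by (simp add: mult.assoc)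
      also have "\<dots> = Z * \<phi> W * X" using \<phi>_swap(1)[OF Z W] by simp
      finally show "X * ?K = ?K * X"
        using C D(2)[OF X] by (simp add: left_diff_distrib right_diff_distrib mult.assoc corner_simps)
    next
      fix Y assume Y: "Y \<in> Peirce Q Q"
      have "\<phi> W * (Z * Y) = - (Y * \<phi> Z * W)"
        using \<phi>_swap(2)[OF W Peirce_closed(1)[OF Z Y]] \<phi>_Y[OF Y Z] by (simp add: mult.assoc)
      also have "\<dots> = Y * \<phi> W * Z" using \<phi>_swap(2)[OF Z W] by (simp add: mult.assoc)
      finally show "Y * ?K = ?K * Y"
        using C D(2)[OF Y] by (simp add: left_diff_distrib right_diff_distrib mult.assoc corner_simps)
    next
      fix V assume V: "V \<in> Peirce P Q"
      have "Z * \<phi> W * V = Z * - (\<phi> V * W)"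
        using \<phi>_swap(2)[OF W V] by (simp add: mult.assoc)
      also have "\<dots> = - (Z * \<phi> V) * W" by (simp add: mult.assoc)
      also have "\<dots> = V * (\<phi> Z * W)"
        using \<phi>_swap(1)[OF Z V] by (simp add: mult.assoc)
      also have "\<dots> = - (V * \<phi> W * Z)" using \<phi>_swap(2)[OF Z W] by (simp add: mult.assoc)
      finally show "V * ?K = ?K * V"
        using C D(2)[OF V] by (simp add: left_diff_distrib right_diff_distrib mult.assoc corner_simps)
    qed
    \<comment> \<open>\<open>Z\<close> anticommutes with \<open>?K\<close>, but a scalar commutes
      with everything; hence \<open>c = 0\<close> or \<open>Z = 0\<close>, and \<open>?K\<close>
      vanishes in either case.\<close>
    have "?K * Z = - (Z * ?K)"
      using C by (simp add: left_diff_distrib right_diff_distrib mult.assoc corner_simps)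
    then have "scale c Z + scale c Z = 0"
      unfolding c by (simp add: scale_mult_left scale_mult_right eq_neg_iff_add_eq_0)
    then have "c = 0 \<or> Z = 0" using double_eq_0[of "scale c Z"] by simp
    then have "?K = 0" using c by auto
    moreover have "P * ?K * P = Z * \<phi> W"
      using C by (simp add: left_diff_distrib right_diff_distrib mult.assoc corner_simps)
    ultimately show "Z * \<phi> W = 0" by simp
  qed
  have map_Z_corner: "\<delta> Z \<in> corner P Q" if "Z \<in> Peirce P Q" for Z
    using map_Z[OF that] \<phi>_0[OF that] by (intro corner_from_sandwich) (simp_all add: \<phi>_def)

  \<comment> \<open>The scalar \<open>\<delta> P + \<delta> Q\<close>\<close>
  have eq_Z': "\<delta> (X * Z) * Y + X * Z * \<delta> Y = \<delta> X * Z * Y + X * \<delta> (Z * Y)"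
    if X: "X \<in> Peirce P P" and Y: "Y \<in> Peirce Q Q" and Z: "Z \<in> Peirce P Q" for X Y Z
    using eq_Z[OF that] that[THEN D(2)] map_Z_corner[OF Peirce_closed(1)[OF X Z]]
      map_Z_corner[OF Peirce_closed(1)[OF Z Y]]
    by (simp add: corner_simps)
  have comm_X: "X * \<delta> P = \<delta> P * X" if X: "X \<in> Peirce P P" for X
  proof -
    have "X * \<delta> P - \<delta> P * X \<in> corner P P"
      using map_X[OF P_Peirce] D(2)[OF X] by (blast intro: corner_closed(1,3))
    \<comment> \<open>Since \<open>\<delta> P * Z = Z * \<delta> Q\<close>, both
      \<open>X * \<delta> P * Z\<close> and \<open>\<delta> P * X * Z\<close> equal
      \<open>X * Z * \<delta> Q\<close>.\<close>
    moreover have "(X * \<delta> P - \<delta> P * X) * Z = 0" if Z: "Z \<in> Peirce P Q" for Z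
      using map_Z(3)[OF Z] map_Z(3)[OF Peirce_closed(1)[OF X Z]]
      by (simp add: left_diff_distrib mult.assoc)
    ultimately show ?thesis using faithful_left by fastforce
  qed
  have comm_Y: "Y * \<delta> Q = \<delta> Q * Y" if Y: "Y \<in> Peirce Q Q" for Y
  proof -
    have "Y * \<delta> Q - \<delta> Q * Y \<in> corner Q Q"
      using map_Y[OF Q_Peirce] D(2)[OF Y] by (blast intro: corner_closed(1,3))
    moreover have "Z * (Y * \<delta> Q - \<delta> Q * Y) = 0" if Z: "Z \<in> Peirce P Q" for Z
      using map_Z(3)[OF Z] map_Z(3)[OF Peirce_closed(1)[OF Z Y]]
      by (simp add: right_diff_distrib flip: mult.assoc)
    ultimately show ?thesis using faithful_right by fastforce
  qed
  note PC = map_X[OF P_Peirce] and QC = map_Y[OF Q_Peirce]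
  obtain c where c: "\<delta> P + \<delta> Q = scale c 1"
  proof (rule commuting_scalar)
    show "X * (\<delta> P + \<delta> Q) = (\<delta> P + \<delta> Q) * X" if "X \<in> Peirce P P" for X
      using comm_X[OF that] D(2)[OF that] QC by (simp add: distrib_left distrib_right corner_simps)
    show "Y * (\<delta> P + \<delta> Q) = (\<delta> P + \<delta> Q) * Y" if "Y \<in> Peirce Q Q" for Y
      using comm_Y[OF that] D(2)[OF that] PC by (simp add: distrib_left distrib_right corner_simps)
    show "Z * (\<delta> P + \<delta> Q) = (\<delta> P + \<delta> Q) * Z" if "Z \<in> Peirce P Q" for Z
      using map_Z(3)[OF that] D(2)[OF that] PC QC
      by (simp add: distrib_left distrib_right corner_simps)
  qed
  have "P * (\<delta> P + \<delta> Q) = \<delta> P" "Q * (\<delta> P + \<delta> Q) = \<delta> Q"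
    using PC QC by (simp_all add: distrib_left corner_simps)
  then have \<delta>_idem: "\<delta> P = scale c P" "\<delta> Q = scale c Q"
    unfolding c by (simp_all add: scale_mult_right)

  \<comment> \<open>Product rule up to the scalar\<close>
  have XZ: "\<delta> (X * Z) = \<delta> X * Z + X * \<delta> Z - scale c (X * Z)"
    if X: "X \<in> Peirce P P" and Z: "Z \<in> Peirce P Q" for X Z
    using eq_Z'[OF X Q_Peirce Z] D(2)[OF X] D(2)[OF Z] map_Z_corner[OF Peirce_closed(1)[OF X Z]]
    by (simp add: \<delta>_idem scale_mult_right mult.assoc corner_simps eq_diff_eq)
  have ZY: "\<delta> (Z * Y) = \<delta> Z * Y + Z * \<delta> Y - scale c (Z * Y)"
    if Y: "Y \<in> Peirce Q Q" and Z: "Z \<in> Peirce P Q" for Y Z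
    using eq_Z'[OF P_Peirce Y Z] D(2)[OF Y] D(2)[OF Z] map_Z_corner[OF Peirce_closed(1)[OF Z Y]]
    by (simp add: \<delta>_idem scale_mult_left mult.assoc corner_simps eq_diff_eq add.commute)
  have XX: "\<delta> (X * X') = \<delta> X * X' + X * \<delta> X' - scale c (X * X')"
    if X: "X \<in> Peirce P P" and X': "X' \<in> Peirce P P" for X X'
  proof -
    \<comment> \<open>The error of the product rule on \<open>X\<close>, \<open>X'\<close>.
      Expanding \<open>\<delta> (X * X' * Z)\<close> under both bracketings shows that it
      annihilates every \<open>Z\<close>, so faithfulness applies.\<close>
    let ?M = "\<delta> (X * X') - (\<delta> X * X' + X * \<delta> X' - scale c (X * X'))"
    have "?M \<in> corner P P"
      using map_X[OF X] map_X[OF X'] map_X[OF Peirce_closed(1)[OF that]] that[THEN D(2)]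
      by (blast intro: corner_closed(1,2,3,6))
    moreover have "?M * Z = 0" if Z: "Z \<in> Peirce P Q" for Z
    proof -
      have "\<delta> (X * X' * Z) = \<delta> (X * X') * Z + X * X' * \<delta> Z - scale c (X * X' * Z)"
        by (rule XZ[OF Peirce_closed(1)[OF X X'] Z])
      moreover have "\<delta> (X * (X' * Z)) =
          \<delta> X * (X' * Z) + X * (\<delta> X' * Z + X' * \<delta> Z - scale c (X' * Z)) - scale c (X * (X' * Z))"
        using XZ[OF X Peirce_closed(1)[OF X' Z]] XZ[OF X' Z] by simp
      ultimately show ?thesis
        by (simp add: algebra_simps scale_mult_left scale_mult_right)
    qed
    ultimately show ?thesis using faithful_left by fastforce
  qed
  have YY: "\<delta> (Y * Y') = \<delta> Y * Y' + Y * \<delta> Y' - scale c (Y * Y')"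
    if Y: "Y \<in> Peirce Q Q" and Y': "Y' \<in> Peirce Q Q" for Y Y'
  proof -
    let ?M = "\<delta> (Y * Y') - (\<delta> Y * Y' + Y * \<delta> Y' - scale c (Y * Y'))"
    have "?M \<in> corner Q Q"
      using map_Y[OF Y] map_Y[OF Y'] map_Y[OF Peirce_closed(1)[OF that]] that[THEN D(2)]
      by (blast intro: corner_closed(1,2,3,6))
    moreover have "Z * ?M = 0" if Z: "Z \<in> Peirce P Q" for Z
    proof -
      have "\<delta> (Z * (Y * Y')) = \<delta> Z * (Y * Y') + Z * \<delta> (Y * Y') - scale c (Z * (Y * Y'))"
        by (rule ZY[OF Peirce_closed(1)[OF Y Y'] Z])
      moreover have "\<delta> (Z * (Y * Y')) =
          (\<delta> Z * Y + Z * \<delta> Y - scale c (Z * Y)) * Y' + Z * Y * \<delta> Y' - scale c (Z * Y * Y')"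
        using ZY[OF Y' Peirce_closed(1)[OF Z Y]] ZY[OF Y Z] by (simp add: mult.assoc)
      ultimately have "\<delta> Z * (Y * Y') + Z * \<delta> (Y * Y') - scale c (Z * (Y * Y')) =
          (\<delta> Z * Y + Z * \<delta> Y - scale c (Z * Y)) * Y' + Z * Y * \<delta> Y' - scale c (Z * Y * Y')"
        by simp
      then show ?thesis
        by (simp add: algebra_simps scale_mult_left scale_mult_right)
    qed
    ultimately show ?thesis using faithful_right by fastforce
  qed
  have "\<delta> (A * B) = \<delta> A * B + A * \<delta> B - scale c (A * B)"
    if A: "A \<in> triangular \<A> P" and B: "B \<in> triangular \<A> P" for A B
  proof -
    obtain X Z Y where a: "X \<in> Peirce P P" "Z \<in> Peirce P Q" "Y \<in> Peirce Q Q" "A = X + Z + Y"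
      using A by (rule triangularE)
    obtain X' Z' Y' where b: "X' \<in> Peirce P P" "Z' \<in> Peirce P Q" "Y' \<in> Peirce Q Q" "B = X' + Z' + Y'"
      using B by (rule triangularE)
    note C = a(1-3)[THEN D(2)] b(1-3)[THEN D(2)] map_X[OF a(1)] map_Z_corner[OF a(2)] map_Y[OF a(3)]
      map_X[OF b(1)] map_Z_corner[OF b(2)] map_Y[OF b(3)]
    note in_A = a(1-3)[THEN D(1)] b(1-3)[THEN D(1)]
    have AB: "A * B = X * X' + X * Z' + Z * Y' + Y * Y'"
      using C by (simp add: a(4) b(4) distrib_left distrib_right corner_simps)
    have "\<delta> (A * B) = \<delta> (X * X') + \<delta> (X * Z') + \<delta> (Z * Y') + \<delta> (Y * Y')"
      unfolding AB using in_A by (simp add: map_add closure)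
    moreover have "\<delta> A = \<delta> X + \<delta> Z + \<delta> Y" "\<delta> B = \<delta> X' + \<delta> Z' + \<delta> Y'"
      using in_A by (simp_all add: a(4) b(4) map_add closure)
    \<comment> \<open>As \<open>\<delta>\<close> preserves the three corners, cross terms of
      \<open>\<delta> A * B\<close> and \<open>A * \<delta> B\<close> vanish just where those of
      \<open>A * B\<close> do.\<close>
    ultimately show ?thesis
      using C unfolding AB
      by (simp add: XX[OF a(1) b(1)] XZ[OF a(1) b(2)] ZY[OF b(3) a(2)] YY[OF a(3) b(3)] a(4) b(4)
          distrib_left distrib_right corner_simps scale_right_distrib)
  qed
  then show ?thesis by (rule that)
qed

section \<open>Undoing the normalisation and eliminating the scalar\<close>

lemma derivation_if_jordan_derivable:
  assumes u: "u \<noteq> 0" "u \<noteq> 1" "u \<noteq> (-1::'k)"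
    and C: "C \<in> triangular \<A> P" "jordan_derivable_at \<A> \<delta> C"
    and spans: "peirce \<A> P P \<subseteq> span (peirce_units \<A> P)" "peirce \<A> Q Q \<subseteq> span (peirce_units \<A> Q)"
  shows "derivation_on scale (triangular \<A> P) \<delta>"
proof -
  \<comment> \<open>Chosen so that \<open>P * k - k * P\<close> is the off-diagonal part of
    \<open>\<delta> P\<close>.\<close>
  define k where "k = P * \<delta> P * Q - Q * \<delta> P * P"
  define \<delta>' where "\<delta>' = (\<lambda>x. \<delta> x - (x * k - k * x))"
  have "linear_map_on scale \<A> \<delta>'"
    by (auto simp: linear_map_on_def \<delta>'_def map_add map_scale distrib_left distrib_right
        scale_mult_left scale_mult_right scale_right_diff_distrib)
  then interpret \<delta>': peirce_linear_map scale \<A> P Q \<delta>'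
    by unfold_locales
  have "\<delta>'.defect (X + X * Z) (Y - Z * Y) = 0"
    if "X \<in> Peirce P P" "Y \<in> Peirce Q Q" "Z \<in> Peirce P Q" for X Y Z
    unfolding \<delta>'_def jordan_defect_diff_inner by (rule defect_orthogonal[OF u C spans that])
  moreover have "P * \<delta>' P * Q = 0" "Q * \<delta>' P * P = 0"
    by (simp_all add: \<delta>'_def k_def left_diff_distrib right_diff_distrib distrib_left distrib_right
        mult.assoc idem_simps)
  ultimately obtain c where c: "\<And>A B. A \<in> triangular \<A> P \<Longrightarrow> B \<in> triangular \<A> P \<Longrightarrow>
      \<delta>' (A * B) = \<delta>' A * B + A * \<delta>' B - scale c (A * B)"
    using \<delta>'.perturbed_derivation by blast
  have eq: "\<delta> (A * B) = \<delta> A * B + A * \<delta> B - scale c (A * B)"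
    if "A \<in> triangular \<A> P" "B \<in> triangular \<A> P" for A B
    using c[OF that] by (simp add: \<delta>'_def algebra_simps)
  \<comment> \<open>Adding the perturbed product rules for \<open>A * B\<close> and
    \<open>B * A\<close> must reproduce the Jordan identity at \<open>C\<close>, so the two scalar
    terms cancel out.\<close>
  have *: "scale c (A * B + B * A) = 0"
    if A: "A \<in> triangular \<A> P" and B: "B \<in> triangular \<A> P" and AB: "A * B = C" for A B
  proof -
    have in_A: "A \<in> \<A>" "B \<in> \<A>" using A B by (auto simp: triangular_def)
    then have "\<delta> (A * B + B * A) = \<delta> A * B + A * \<delta> B + \<delta> B * A + B * \<delta> A"
      using C(2) AB by (auto simp: jordan_derivable_at_def)
    moreover have "\<delta> (A * B + B * A) = \<delta> (A * B) + \<delta> (B * A)"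
      using in_A by (simp add: map_add closure)
    ultimately show ?thesis
      by (simp add: eq[OF A B] eq[OF B A] scale_right_distrib algebra_simps)
  qed
  have "c = 0"
  proof (cases "C = 0")
    case False
    \<comment> \<open>The factorisation \<open>1 * C = C\<close> yields twice
      \<open>scale c C\<close>.\<close>
    have "1 \<in> triangular \<A> P"
      by (simp add: triangular_def one_in algebra_simps PP)
    from *[OF this C(1)] have "scale c C = 0"
      using double_eq_0[of "scale c C"] by (simp add: scale_right_distrib)
    with False show ?thesis by simp
  next
    case True
    \<comment> \<open>If the \<open>P\<close>, \<open>Q\<close> component of \<open>\<A>\<close>
      were zero, faithfulness would give \<open>P = 0\<close>. The pair \<open>Q\<close>,
      \<open>Z\<close> then has product 0 in one order and \<open>Z\<close> in the other.\<close>
    obtain Z where Z: "Z \<in> Peirce P Q" "Z \<noteq> 0"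
      using faithful_left[OF P_corner] P_nonzero by fastforce
    have "Q * Z = 0" "Z * Q = Z" using Peirce_D(2)[OF Z(1)] by (simp_all add: corner_simps)
    with *[of Q Z] Z Q_Peirce Peirce_subset_triangular True have "scale c Z = 0" by auto
    with Z(2) show ?thesis by simp
  qed
  then show ?thesis
    using linear eq subalgebra_triangular
    by (auto simp: derivation_on_def linear_map_on_def triangular_def)
qed

end

theorem theorem2p5:
  fixes scale :: "'k::field \<Rightarrow> 'b::ring_1 \<Rightarrow> 'b"
    and \<A> :: "'b set" and P C :: 'b and \<delta> :: "'b \<Rightarrow> 'b"
  assumes "CHAR('k) \<noteq> 2"
    and "infinite (UNIV :: 'k set) \<or> card (UNIV :: 'k set) \<ge> 4"
    and "algebra_over scale"
    and "subalgebra scale \<A>" and "1 \<in> \<A>"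
    and "P \<in> \<A>" and "P * P = P" and "P \<noteq> 0" and "P \<noteq> 1"
    and "peirce \<A> P P \<subseteq> module.span scale (peirce_units \<A> P)"
    and "peirce \<A> (1 - P) (1 - P) \<subseteq> module.span scale (peirce_units \<A> (1 - P))"
    and "peirce12_faithful \<A> P"
    and "commutant (triangular \<A> P) = range (\<lambda>c. scale c 1)"
    and "linear_map_on scale \<A> \<delta>"
    and "C \<in> triangular \<A> P"
    and "jordan_derivable_at \<A> \<delta> C"
  shows "derivation_on scale (triangular \<A> P) \<delta>"
proof -
  \<comment> \<open>Four scalars leave one outside 0, 1 and -1, the third evaluation point for
    comparing coefficients of \<open>t\<close>.\<close>
  have "\<exists>u::'k. u \<notin> {0, 1, -1}"
  proof (rule ccontr)
    assume "\<nexists>u::'k. u \<notin> {0, 1, -1}"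
    then have UNIV: "(UNIV :: 'k set) = {0, 1, -1}" by auto
    have "card {0, 1, -1 :: 'k} \<le> 3"
      using card_length[of "[0, 1, -1 :: 'k]"] by simp
    with assms(2) show False unfolding UNIV by simp
  qed
  then obtain u :: 'k where u: "u \<noteq> 0" "u \<noteq> 1" "u \<noteq> -1" by auto
  interpret algebra_over scale by fact
  interpret peirce_linear_map scale \<A> P "1 - P" \<delta>
    using assms by unfold_locales auto
  show ?thesis
    using assms by (intro derivation_if_jordan_derivable[OF u])
qed

end
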